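(* There is an algorithm that solves Balanced Vertex in ${\cal O}(n)$ time on instances $(G,\pi,S)$ where $G$ is a clique (complete graph) with $n$ vertices.
   Context: All graphs are finite, simple, connected, with unit-length edges; $d(u,v)$ is the shortest-path distance. A proper vertex list is a list $S=(s_1,\ldots,s_p)$ of pairwise different vertices; $d(v,S)=\min_i d(v,s_i)$. The (prioritized) Voronoi diagram of $G=(V,E)$ with respect to $S$ is the partition of $V$ into territories $\mathbb{T}(s_1,S),\ldots,\mathbb{T}(s_p,S)$ where $v\in\mathbb{T}(s_i,S)$ if and only if $d(v,s_i)=d(v,S)$ and $d(v,s_j)>d(v,S)$ for every $j$ with $1\le j<i$. For a cost function $\pi:V\to\mathbb{R}_{\ge 0}$, the load of $s_i$ is $\ell_\pi(s_i,S)=\sum_{v\in\mathbb{T}(s_i,S)}\pi(v)$, and $L_\pi(S)=\max_i \ell_\pi(s_i,S)$. For $v\in V\setminus S$, $S+v=(s_1,\ldots,s_p,v)$. Balanced Vertex: given a graph $G=(V,E)$, a cost function $\pi:V\to\mathbb{R}_{\ge 0}$ and a proper vertex list $S$, output a vertex $v\in V\setminus S$ such that $L_\pi(S+v)$ is minimized. Running times are worst-case, in the usual unit-cost RAM model. *)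

theory Defs
  imports "Graph_Theory.Graph_Theory" "HOL-Library.Landau_Symbols"
begin

section \<open>Balanced Vertex\<close>

text \<open>Undirected graphs are symmetric digraphs (locale \<^locale>\<open>pair_graph\<close>): an edge is a
  pair of opposite arcs.\<close>

definition graph_dist :: "'a pair_pre_digraph \<Rightarrow> 'a \<Rightarrow> 'a \<Rightarrow> ereal" where
  "graph_dist G = wf_digraph.\<mu> (with_proj G) (\<lambda>_. 1)"

definition dist_to_list :: "'a pair_pre_digraph \<Rightarrow> 'a \<Rightarrow> 'a list \<Rightarrow> ereal" where
  "dist_to_list G v S = Min (graph_dist G v ` set S)"

definition proper_vertex_list :: "'a pair_pre_digraph \<Rightarrow> 'a list \<Rightarrow> bool" where
  "proper_vertex_list G S \<longleftrightarrow> distinct S \<and> set S \<subseteq> pverts G"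

text \<open>List positions start at 0.\<close>

definition territory :: "'a pair_pre_digraph \<Rightarrow> 'a list \<Rightarrow> nat \<Rightarrow> 'a set" where
  "territory G S i =
     {v \<in> pverts G. graph_dist G v (S ! i) = dist_to_list G v S \<and>
        (\<forall>j<i. graph_dist G v (S ! j) > dist_to_list G v S)}"

definition load :: "'a pair_pre_digraph \<Rightarrow> ('a \<Rightarrow> real) \<Rightarrow> 'a list \<Rightarrow> nat \<Rightarrow> real" where
  "load G \<pi> S i = (\<Sum>v\<in>territory G S i. \<pi> v)"

definition max_load :: "'a pair_pre_digraph \<Rightarrow> ('a \<Rightarrow> real) \<Rightarrow> 'a list \<Rightarrow> real" where
  "max_load G \<pi> S = Max (load G \<pi> S ` {..<length S})"

text \<open>An output vertex exists only if \<open>S\<close> leaves some vertex out. The empty list is allowed,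
  since only the values \<open>max_load G \<pi> (S @ [v])\<close> matter.\<close>

definition balanced_vertex_instance ::
    "'a pair_pre_digraph \<Rightarrow> ('a \<Rightarrow> real) \<Rightarrow> 'a list \<Rightarrow> bool" where
  "balanced_vertex_instance G \<pi> S \<longleftrightarrow>
     pair_graph G \<and> Digraph_Component.connected (with_proj G) \<and>
     (\<forall>v\<in>pverts G. 0 \<le> \<pi> v) \<and>
     proper_vertex_list G S \<and> pverts G - set S \<noteq> {}"

definition balanced_vertex_solution ::
    "'a pair_pre_digraph \<Rightarrow> ('a \<Rightarrow> real) \<Rightarrow> 'a list \<Rightarrow> 'a \<Rightarrow> bool" where
  "balanced_vertex_solution G \<pi> S v \<longleftrightarrow>
     v \<in> pverts G - set S \<and>
     (\<forall>u\<in>pverts G - set S. max_load G \<pi> (S @ [v]) \<le> max_load G \<pi> (S @ [u]))"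


section \<open>Unit-cost RAM\<close>

text \<open>Since costs are real numbers, the machine has two sorts of registers and of randomly
  accessible memory cells: naturals (vertices, counters, addresses; subtraction truncates at 0)
  and reals. A program is a finite list of instructions, independent of the input, so it uses
  finitely many registers and constants. Every instruction costs one time step. The only
  arithmetic is addition and subtraction; in particular neither multiplication of unbounded
  integers nor any passage from reals to naturals (rounding) is available at unit cost.\<close>

datatype instr =
    NConst nat nat
  | NAdd nat nat nat
  | NSub nat nat nat
  | NLoad nat nat
  | NStore nat nat
  | NJumpLess nat nat nat
  | RConst nat nat
  | RAdd nat nat nat
  | RSub nat nat nat
  | RLoad nat nat
  | RStore nat nat
  | RJumpLess nat nat nat

record ram_state =
  pc :: nat
  nreg :: "nat \<Rightarrow> nat"
  rreg :: "nat \<Rightarrow> real"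
  nmem :: "nat \<Rightarrow> nat"
  rmem :: "nat \<Rightarrow> real"

fun exec :: "instr \<Rightarrow> ram_state \<Rightarrow> ram_state" where
  "exec (NConst i c) s = s\<lparr>pc := Suc (pc s), nreg := (nreg s)(i := c)\<rparr>"
| "exec (NAdd i j k) s = s\<lparr>pc := Suc (pc s), nreg := (nreg s)(i := nreg s j + nreg s k)\<rparr>"
| "exec (NSub i j k) s = s\<lparr>pc := Suc (pc s), nreg := (nreg s)(i := nreg s j - nreg s k)\<rparr>"
| "exec (NLoad i j) s = s\<lparr>pc := Suc (pc s), nreg := (nreg s)(i := nmem s (nreg s j))\<rparr>"
| "exec (NStore i j) s = s\<lparr>pc := Suc (pc s), nmem := (nmem s)(nreg s i := nreg s j)\<rparr>"
| "exec (NJumpLess i j l) s = s\<lparr>pc := (if nreg s i < nreg s j then l else Suc (pc s))\<rparr>"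
| "exec (RConst i c) s = s\<lparr>pc := Suc (pc s), rreg := (rreg s)(i := real c)\<rparr>"
| "exec (RAdd i j k) s = s\<lparr>pc := Suc (pc s), rreg := (rreg s)(i := rreg s j + rreg s k)\<rparr>"
| "exec (RSub i j k) s = s\<lparr>pc := Suc (pc s), rreg := (rreg s)(i := rreg s j - rreg s k)\<rparr>"
| "exec (RLoad i j) s = s\<lparr>pc := Suc (pc s), rreg := (rreg s)(i := rmem s (nreg s j))\<rparr>"
| "exec (RStore i j) s = s\<lparr>pc := Suc (pc s), rmem := (rmem s)(nreg s i := rreg s j)\<rparr>"
| "exec (RJumpLess i j l) s = s\<lparr>pc := (if rreg s i < rreg s j then l else Suc (pc s))\<rparr>"

text \<open>A machine halts when the program counter leaves the program.\<close>

definition halted :: "instr list \<Rightarrow> ram_state \<Rightarrow> bool" where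
  "halted P s \<longleftrightarrow> length P \<le> pc s"

definition ram_step :: "instr list \<Rightarrow> ram_state \<Rightarrow> ram_state" where
  "ram_step P s = (if halted P s then s else exec (P ! pc s) s)"

definition halts_from :: "instr list \<Rightarrow> ram_state \<Rightarrow> bool" where
  "halts_from P s \<longleftrightarrow> (\<exists>t. halted P ((ram_step P ^^ t) s))"

definition running_time :: "instr list \<Rightarrow> ram_state \<Rightarrow> nat" where
  "running_time P s = (LEAST t. halted P ((ram_step P ^^ t) s))"

text \<open>The result is found in natural register 0.\<close>

definition ram_output :: "instr list \<Rightarrow> ram_state \<Rightarrow> nat" where
  "ram_output P s = nreg ((ram_step P ^^ running_time P s) s) 0"


section \<open>Encoding of instances\<close>

text \<open>For the machine the vertices are the numbers \<open>0, \<dots>, n - 1\<close>. The graph is given by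
  adjacency lists, whose internal order is arbitrary.\<close>

definition adjacency_lists :: "nat pair_pre_digraph \<Rightarrow> (nat \<Rightarrow> nat list) \<Rightarrow> bool" where
  "adjacency_lists G adj \<longleftrightarrow>
     (\<forall>v\<in>pverts G. distinct (adj v) \<and> set (adj v) = {w. (v, w) \<in> parcs G})"

text \<open>Contents of the natural memory: \<open>n\<close>, the length of \<open>S\<close>, the list \<open>S\<close>, a table of
  \<open>n + 1\<close> offsets, and the concatenated adjacency lists; the list of vertex \<open>v\<close> occupies the
  positions from offset \<open>v\<close> up to, but excluding, offset \<open>v + 1\<close> in that concatenation.\<close>

definition encode_nats :: "nat \<Rightarrow> nat list \<Rightarrow> (nat \<Rightarrow> nat list) \<Rightarrow> nat list" where
  "encode_nats n S adj =
     [n, length S] @ S @ map (\<lambda>v. \<Sum>u<v. length (adj u)) [0..<Suc n] @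
     concat (map adj [0..<n])"

text \<open>The input is resident in memory when the machine starts, so reading it is not charged
  unless the program accesses it. The real memory holds the cost of vertex \<open>v\<close> at address \<open>v\<close>.
  All remaining cells are 0.\<close>

definition initial_state ::
    "nat \<Rightarrow> (nat \<Rightarrow> nat list) \<Rightarrow> (nat \<Rightarrow> real) \<Rightarrow> nat list \<Rightarrow> ram_state" where
  "initial_state n adj \<pi> S =
     \<lparr>pc = 0, nreg = (\<lambda>_. 0), rreg = (\<lambda>_. 0),
      nmem = (\<lambda>a. if a < length (encode_nats n S adj) then encode_nats n S adj ! a else 0),
      rmem = (\<lambda>a. if a < n then \<pi> a else 0)\<rparr>"

end

theory Submission
  imports Defs
begin

text \<open>In a clique every vertex outside \<open>S\<close> is at distance 1 from all of \<open>S\<close>, so it belongs to the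
  first territory, and every other territory is a singleton. Let \<open>R\<close> be the load of the first
  vertex of \<open>S\<close> before anything is appended. Appending \<open>v\<close> changes this load to \<open>R - \<pi> v\<close>, creates a
  new load \<open>\<pi> v\<close>, and leaves all other loads as they are; hence it suffices to minimise
  \<open>max (R - \<pi> v) (\<pi> v)\<close>. Three linear passes do this: one over \<open>S\<close> marks its vertices, one over all
  vertices computes \<open>R\<close>, and one finds the minimum. The adjacency lists are never read.
  If \<open>S\<close> is empty, every vertex is a solution, and \<open>R\<close> is taken to be the total cost.\<close>

section \<open>Loads in a clique\<close>

context
  fixes n :: nat and G :: "'a pair_pre_digraph"
  assumes complete: "complete_digraph n (with_proj G)"
begin

lemma finite_pverts_complete: "finite (pverts G)"
  using complete by (simp add: complete_digraph_pair_def)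

text \<open>\<open>\<mu>\<close> is an infimum of walk costs: a walk between different vertices has
  at least one arc, and the empty walk or a single arc attains the bound.\<close>

lemma graph_dist_complete:
  assumes "u \<in> pverts G" "v \<in> pverts G"
  shows "graph_dist G u v = (if u = v then 0 else 1)"
proof -
  interpret graph "with_proj G"
    using complete by (simp add: complete_digraph_def)
  let ?c = "\<lambda>_. 1 :: real"
  have cost: "awalk_cost ?c p = real (length p)" for p
    by (simp add: awalk_cost_def sum_list_triv)
  have lower: "(if u = v then 0 else 1) \<le> ereal (awalk_cost ?c p)" if "awalk u p v" for p
    using that by (cases p) (auto simp: cost awalk_Nil_iff)
  have "\<exists>p. awalk u p v \<and> ereal (awalk_cost ?c p) = (if u = v then 0 else 1)"
  proof (cases "u = v")
    case True
    then show ?thesis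
      using assms by (intro exI[of _ "[]"]) (simp add: awalk_Nil_iff zero_ereal_def)
  next
    case False
    then have "(u, v) \<in> parcs G"
      using assms complete by (auto simp: complete_digraph_pair_def)
    then show ?thesis
      using assms False by (intro exI[of _ "[(u, v)]"]) (simp add: awalk_simps one_ereal_def)
  qed
  then show ?thesis
    unfolding graph_dist_def \<mu>_def
    by (intro antisym INF_greatest) (auto simp: lower intro: INF_lower2)
qed

lemma dist_to_list_complete:
  assumes "v \<in> pverts G" "set S \<subseteq> pverts G" "S \<noteq> []"
  shows "dist_to_list G v S = (if v \<in> set S then 0 else 1)"
proof -
  have "graph_dist G v ` set S = (\<lambda>s. if v = s then 0 else 1) ` set S"
    using assms by (intro image_cong) (auto simp: graph_dist_complete)
  also have "Min \<dots> = (if v \<in> set S then 0 else 1)"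
    using assms(3) by (cases S) (auto intro!: Min_eqI)
  finally show ?thesis
    by (simp add: dist_to_list_def)
qed

lemma territory_complete:
  assumes "proper_vertex_list G S" "i < length S"
  shows "territory G S i = insert (S ! i) (if i = 0 then pverts G - set S else {})"
proof -
  have S: "set S \<subseteq> pverts G" "S \<noteq> []" "distinct S"
    using assms by (auto simp: proper_vertex_list_def)
  have nth: "S ! j \<in> pverts G" if "j \<le> i" for j
    using that assms S by (auto intro!: subsetD[OF S(1)] nth_mem)
  have "v \<in> territory G S i \<longleftrightarrow> v \<in> insert (S ! i) (if i = 0 then pverts G - set S else {})" for v
  proof (cases "v \<in> pverts G")
    case True
    then have "v \<in> territory G S i \<longleftrightarrow>
        (if v = S ! i then 0 else 1) = (if v \<in> set S then 0 else 1 :: ereal) \<and>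
        (\<forall>j<i. (if v \<in> set S then 0 else 1) < (if v = S ! j then 0 else 1 :: ereal))"
      using S nth by (simp add: territory_def dist_to_list_complete graph_dist_complete)
    also have "\<dots> \<longleftrightarrow> v \<in> insert (S ! i) (if i = 0 then pverts G - set S else {})"
      using True assms(2) S(3) nth_mem[OF assms(2)] nth_mem[of 0 S]
      by (cases "v = S ! i"; cases "v \<in> set S")
        (auto simp: nth_eq_iff_index_eq)
    finally show ?thesis .
  next
    case False
    then show ?thesis
      using nth[of i] by (auto simp: territory_def)
  qed
  then show ?thesis
    by blast
qed

lemma load_complete:
  assumes "proper_vertex_list G S" "i < length S"
  shows "load G \<pi> S i = \<pi> (S ! i) + (if i = 0 then sum \<pi> (pverts G - set S) else 0)"
  unfolding load_def territory_complete[OF assms]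
  using finite_pverts_complete nth_mem[OF assms(2)] by (cases i) simp_all

lemma balanced_vertex_solution_complete:
  assumes S: "proper_vertex_list G S" and v: "v \<in> pverts G - set S"
    and R: "R = (if S = [] then 0 else \<pi> (hd S)) + sum \<pi> (pverts G - set S)"
    and min: "\<And>u. u \<in> pverts G - set S \<Longrightarrow> max (R - \<pi> v) (\<pi> v) \<le> max (R - \<pi> u) (\<pi> u)"
  shows "balanced_vertex_solution G \<pi> S v"
proof -
  \<comment> \<open>If \<open>S\<close> is empty, \<open>u\<close> itself gets position 0 and
    attracts all vertices, so the load is \<open>R\<close> whatever \<open>u\<close> is.\<close>
  have load: "load G \<pi> (S @ [u]) i =
      (if i = length S \<and> S \<noteq> [] then \<pi> u else if i = 0 then (if S = [] then R else R - \<pi> u)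
       else \<pi> (S ! i))"
    if u: "u \<in> pverts G - set S" and i: "i < length (S @ [u])" for u i
  proof -
    have proper: "proper_vertex_list G (S @ [u])"
      using S u by (auto simp: proper_vertex_list_def)
    have "pverts G - set (S @ [u]) = pverts G - set S - {u}"
      by auto
    then have "sum \<pi> (pverts G - set S) = \<pi> u + sum \<pi> (pverts G - set (S @ [u]))"
      using u finite_pverts_complete by (simp add: sum.remove)
    then show ?thesis
      unfolding load_complete[OF proper i] R
      using i by (auto simp: nth_append hd_conv_nth simp del: set_append)
  qed
  have "max_load G \<pi> (S @ [v]) \<le> max_load G \<pi> (S @ [u])" if u: "u \<in> pverts G - set S" for u
  proof -
    have le: "load G \<pi> (S @ [u]) i \<le> max_load G \<pi> (S @ [u])" if "i \<le> length S" for i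
      using that by (auto simp: max_load_def intro!: Max_ge)
    \<comment> \<open>Only positions 0 and \<open>length S\<close> depend on the appended vertex,
      and \<open>min\<close> compares their larger load; the load at any other position also occurs
      for \<open>S @ [u]\<close>.\<close>
    have "load G \<pi> (S @ [v]) i \<le> max_load G \<pi> (S @ [u])" if i: "i \<le> length S" for i
    proof (cases "S = []")
      case True
      then show ?thesis
        using le[OF i] i load u v by simp
    next
      case False
      then have "max (R - \<pi> u) (\<pi> u) \<le> max_load G \<pi> (S @ [u])"
        using le[of 0] le[of "length S"] u by (simp add: load)
      with min[OF u] show ?thesis
        using False le[OF i] i u v by (auto simp: load split: if_splits)
    qed
    then show ?thesis
      unfolding max_load_def[of G \<pi> "S @ [v]"] by (intro Max.boundedI) auto
  qed
  with v show ?thesis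
    by (simp add: balanced_vertex_solution_def)
qed

end


section \<open>Time-bounded runs\<close>

text \<open>\<open>Q\<close> need hold only at some moment within the budget, so that budgets add up
  under sequencing.\<close>

definition runs :: "instr list \<Rightarrow> ram_state \<Rightarrow> nat \<Rightarrow> (ram_state \<Rightarrow> bool) \<Rightarrow> bool" where
  "runs P s k Q \<longleftrightarrow> (\<exists>t\<le>k. Q ((ram_step P ^^ t) s))"

lemma runsI: "Q ((ram_step P ^^ t) s) \<Longrightarrow> t \<le> k \<Longrightarrow> runs P s k Q"
  by (auto simp: runs_def)

lemma runs_mono: "runs P s k Q \<Longrightarrow> k \<le> l \<Longrightarrow> runs P s l Q"
  by (auto simp: runs_def intro: order_trans)

lemma runs_seq:
  assumes "runs P s k Q" "\<And>s'. Q s' \<Longrightarrow> runs P s' l R"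
  shows "runs P s (k + l) R"
proof -
  obtain t where t: "t \<le> k" "Q ((ram_step P ^^ t) s)"
    using assms by (auto simp: runs_def)
  then obtain u where "u \<le> l" "R ((ram_step P ^^ u) ((ram_step P ^^ t) s))"
    using assms(2) by (auto simp: runs_def)
  then show ?thesis
    using t unfolding runs_def by (intro exI[of _ "u + t"]) (auto simp: funpow_add)
qed

text \<open>The invariant is indexed by the iterations still to come, matching the program's loop
  counters, which run down to 0.\<close>

lemma runs_loop:
  assumes "\<And>i s. Suc i \<le> k \<Longrightarrow> I (Suc i) s \<Longrightarrow> runs P s c (I i)" "I k s"
  shows "runs P s (k * c) (I 0)"
  using assms
proof (induction k arbitrary: s)
  case 0
  then show ?case
    by (simp add: runs_def)
next
  case (Suc k)
  have "runs P s (c + k * c) (I 0)"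
    by (rule runs_seq[of P s c "I k"]) (use Suc in auto)
  then show ?case
    by simp
qed

text \<open>A halted state is a fixed point of \<open>ram_step\<close>, so the halted state that was
  reached is also the one at the least halting time.\<close>

lemma runs_halted:
  assumes "runs P s k (\<lambda>s'. halted P s' \<and> Q (nreg s' 0))"
  shows "halts_from P s" "running_time P s \<le> k" "Q (ram_output P s)"
proof -
  obtain t where t: "t \<le> k" "halted P ((ram_step P ^^ t) s)" "Q (nreg ((ram_step P ^^ t) s) 0)"
    using assms by (auto simp: runs_def)
  then show "halts_from P s"
    by (auto simp: halts_from_def)
  have le: "running_time P s \<le> t"
    unfolding running_time_def by (rule Least_le) (rule t)
  then show "running_time P s \<le> k"
    using t by simp
  have halted: "halted P ((ram_step P ^^ running_time P s) s)"
    unfolding running_time_def by (rule LeastI) (rule t)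
  have stable: "(ram_step P ^^ m) s' = s'" if "halted P s'" for m s'
    by (induction m) (simp_all add: ram_step_def that)
  have "(ram_step P ^^ t) s = (ram_step P ^^ (t - running_time P s))
      ((ram_step P ^^ running_time P s) s)"
    using le by (simp flip: funpow_add comp_apply[of "_ ^^ _" "_ ^^ _"])
  also have "\<dots> = (ram_step P ^^ running_time P s) s"
    by (rule stable[OF halted])
  finally show "Q (ram_output P s)"
    using t by (simp add: ram_output_def)
qed


section \<open>The program\<close>

text \<open>Costs are nonnegative, so overwriting the cost of a vertex with \<open>- 1\<close> marks it as a member of \<open>S\<close>.
  The list \<open>S\<close> is traversed backwards so that the last cost read is that of its first vertex, which
  then starts the sum \<open>R\<close>. The minimum also starts at \<open>R\<close>: no candidate exceeds it, and ties
  update the output.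

  Natural registers: 0 output, 1 the constant 1, 2 the constant 0, 3 loop counter, 4 address,
  5 vertex, 6 \<open>n\<close>. Real registers: 0 the constant 0, 1 the constant \<open>- 1\<close>, 2 current cost, 3 \<open>R\<close>,
  4 minimum so far, 5 current candidate. The loop tests are at positions 11, 18 and 31.\<close>

definition clique_program :: "instr list" where
  "clique_program =
    [NConst 1 1,
     NLoad 6 2,
     NLoad 3 1,
     RConst 1 1,
     RSub 1 0 1,
     NJumpLess 2 1 11,
     NAdd 4 3 1,
     NLoad 5 4,
     RLoad 3 5,
     RStore 5 1,
     NSub 3 3 1,
     NJumpLess 2 3 6,
     NAdd 3 6 2,
     NJumpLess 2 1 18,
     NSub 3 3 1,
     RLoad 2 3,
     RJumpLess 2 0 18,
     RAdd 3 3 2,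
     NJumpLess 2 3 14,
     NAdd 3 6 2,
     RAdd 4 3 0,
     NJumpLess 2 1 31,
     NSub 3 3 1,
     RLoad 2 3,
     RJumpLess 2 0 31,
     RSub 5 3 2,
     RJumpLess 2 5 28,
     RAdd 5 2 0,
     RJumpLess 4 5 31,
     RAdd 4 5 0,
     NAdd 0 3 2,
     NJumpLess 2 3 22]"

text \<open>Peels off the first step rather than the last, so that the simplifier executes the
  program symbolically from a known state.\<close>

lemma funpow_numeral_apply: "(f ^^ numeral k) x = (f ^^ pred_numeral k) (f x)"
  by (simp add: numeral_eq_Suc funpow_swap1)

lemmas execute = funpow_numeral_apply ram_step_def halted_def clique_program_def

section \<open>Loop invariants and step counts of the three passes\<close>

context
  fixes n :: nat and \<pi> :: "nat \<Rightarrow> real" and S :: "nat list"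
  assumes distinct: "distinct S" and S_less: "set S \<subseteq> {..<n}"
    and nonneg: "\<And>v. v < n \<Longrightarrow> 0 \<le> \<pi> v"
begin

definition constants :: "ram_state \<Rightarrow> bool" where
  "constants s \<longleftrightarrow> nreg s 1 = 1 \<and> nreg s 2 = 0 \<and> nreg s 6 = n \<and> rreg s 0 = 0 \<and> rreg s 1 = -1"

definition first_cost :: real where
  "first_cost = (if S = [] then 0 else \<pi> (hd S))"

text \<open>The entries of \<open>S\<close> from position \<open>i\<close> on are already marked.
  The offset 2 skips the cells with \<open>n\<close> and the length of \<open>S\<close>.\<close>

definition mark_inv :: "nat \<Rightarrow> ram_state \<Rightarrow> bool" where
  "mark_inv i s \<longleftrightarrow> constants s \<and> pc s = 11 \<and> nreg s 3 = i \<and>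
     (\<forall>j<length S. nmem s (j + 2) = S ! j) \<and>
     (\<forall>v<n. rmem s v = (if v \<in> set (drop i S) then -1 else \<pi> v)) \<and>
     rreg s 3 = (if i < length S then \<pi> (S ! i) else 0)"

definition marked :: "ram_state \<Rightarrow> bool" where
  "marked s \<longleftrightarrow> constants s \<and> (\<forall>v<n. rmem s v = (if v \<in> set S then -1 else \<pi> v))"

definition sum_inv :: "nat \<Rightarrow> ram_state \<Rightarrow> bool" where
  "sum_inv i s \<longleftrightarrow> marked s \<and> pc s = 18 \<and> nreg s 3 = i \<and>
     rreg s 3 = first_cost + sum \<pi> ({i..<n} - set S)"

abbreviation (input) total :: real where
  "total \<equiv> first_cost + sum \<pi> ({..<n} - set S)"

definition key :: "nat \<Rightarrow> real" where
  "key v = max (total - \<pi> v) (\<pi> v)"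

definition min_inv :: "nat \<Rightarrow> ram_state \<Rightarrow> bool" where
  "min_inv i s \<longleftrightarrow> marked s \<and> pc s = 31 \<and> nreg s 3 = i \<and> rreg s 3 = total \<and>
     (\<forall>v\<in>{i..<n} - set S. rreg s 4 \<le> key v) \<and>
     (if {i..<n} - set S = {} then rreg s 4 = total
      else nreg s 0 \<in> {i..<n} - set S \<and> rreg s 4 = key (nreg s 0))"

text \<open>Makes \<open>total\<close> a safe initial minimum: subtracting a nonnegative cost cannot
  exceed it, and \<open>\<pi> v\<close> is one of its nonnegative summands.\<close>

lemma key_le_total:
  assumes "v \<in> {..<n} - set S"
  shows "key v \<le> total"
proof -
  have "0 \<le> first_cost"
    using subsetD[OF S_less hd_in_set] nonneg by (auto simp: first_cost_def)
  moreover have "\<pi> v \<le> sum \<pi> ({..<n} - set S)"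
    using assms by (intro member_le_sum nonneg) auto
  ultimately show ?thesis
    using assms nonneg by (auto simp: key_def)
qed

lemma diff_set_atLeast_Suc:
  assumes "Suc i \<le> n"
  shows "{i..<n} - set S =
    (if i \<in> set S then {Suc i..<n} - set S else insert i ({Suc i..<n} - set S))"
  using assms by (auto simp: Suc_le_eq le_less)

lemma mark_step:
  assumes "Suc i \<le> length S" "mark_inv (Suc i) s"
  shows "runs clique_program s 6 (mark_inv i)"
proof -
  have drop: "drop i S = S ! i # drop (Suc i) S"
    using assms by (simp add: Cons_nth_drop_Suc)
  \<comment> \<open>Distinctness ensures that the cost read here has not yet been overwritten by the
    marker.\<close>
  have "S ! i \<notin> set (drop (Suc i) S)"
    using distinct_drop[OF distinct, of i] by (simp add: drop)
  moreover have "S ! i < n"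
    using assms subsetD[OF S_less nth_mem[of i S]] by simp
  ultimately have "rmem s (S ! i) = \<pi> (S ! i)" "nmem s (Suc (Suc i)) = S ! i"
    using assms by (auto simp: mark_inv_def)
  with assms show ?thesis
    by (intro runsI[where t = 6]) (simp_all add: execute mark_inv_def constants_def drop)
qed

text \<open>The sign test skips exactly the marked vertices, since genuine costs are nonnegative;
  the skip saves one step.\<close>

lemma sum_step:
  assumes "Suc i \<le> n" "sum_inv (Suc i) s"
  shows "runs clique_program s 5 (sum_inv i)"
proof (cases "i \<in> set S")
  case True
  with assms show ?thesis
    by (intro runsI[where t = 4])
      (simp_all add: execute sum_inv_def marked_def constants_def diff_set_atLeast_Suc)
next
  case False
  moreover have "0 \<le> \<pi> i"
    using assms nonneg by simp
  ultimately show ?thesis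
    using assms
    by (intro runsI[where t = 5])
      (simp_all add: execute sum_inv_def marked_def constants_def diff_set_atLeast_Suc)
qed

text \<open>Separates the reasoning about minima from the machine: \<open>min_step\<close> then only
  has to execute each path.\<close>

lemma min_inv_Suc:
  assumes "Suc i \<le> n" "min_inv (Suc i) s" "marked s'" "pc s' = 31" "nreg s' 3 = i"
    "rreg s' 3 = total"
    "if i \<in> set S \<or> rreg s 4 < key i
     then rreg s' 4 = rreg s 4 \<and> nreg s' 0 = nreg s 0
     else rreg s' 4 = key i \<and> nreg s' 0 = i"
  shows "min_inv i s'"
proof -
  note inv = assms(2)[unfolded min_inv_def]
  show ?thesis
  proof (cases "i \<in> set S")
    case True
    then show ?thesis
      using assms(3-) inv unfolding min_inv_def diff_set_atLeast_Suc[OF assms(1)]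
      by (simp split: if_splits)
  next
    case False
    then have D: "{i..<n} - set S = insert i ({Suc i..<n} - set S)"
      by (simp add: diff_set_atLeast_Suc[OF assms(1)])
    show ?thesis
    proof (cases "rreg s 4 < key i")
      case True
      moreover have "key i \<le> total"
        using assms(1) False by (intro key_le_total) simp
      \<comment> \<open>A rejected candidate shows that the minimum is below \<open>total\<close>,
        hence no longer the initial value: register 0 already holds a vertex.\<close>
      ultimately have "{Suc i..<n} - set S \<noteq> {}"
        using inv by (metis not_less)
      then have "nreg s 0 \<in> {Suc i..<n} - set S" "rreg s 4 = key (nreg s 0)"
        "\<forall>v\<in>{Suc i..<n} - set S. rreg s 4 \<le> key v"
        using inv by metis+
      then show ?thesis
        using assms(3-) True False unfolding min_inv_def D by auto
    next
      case le: False
      then have "\<forall>v\<in>{Suc i..<n} - set S. key i \<le> key v"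
        using inv by (meson order_trans not_less)
      then show ?thesis
        using assms(3-) False le unfolding min_inv_def D by simp
    qed
  qed
qed

lemma min_step:
  assumes "Suc i \<le> n" "min_inv (Suc i) s"
  shows "runs clique_program s 10 (min_inv i)"
proof (cases "i \<in> set S")
  case True
  with assms show ?thesis
    by (intro runsI[where t = 4] min_inv_Suc[OF assms])
      (simp_all add: execute min_inv_def marked_def constants_def)
next
  case False
  have \<pi>: "0 \<le> \<pi> i"
    using assms nonneg by simp
  \<comment> \<open>One jump selects the larger of the two loads, the other compares it with the
    minimum; the four paths differ in length.\<close>
  consider
      "\<pi> i < total - \<pi> i" "rreg s 4 < key i" | "\<pi> i < total - \<pi> i" "\<not> rreg s 4 < key i"
    | "\<not> \<pi> i < total - \<pi> i" "rreg s 4 < key i" | "\<not> \<pi> i < total - \<pi> i" "\<not> rreg s 4 < key i"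
    by blast
  then show ?thesis
  proof cases
    case 1
    with assms False \<pi> show ?thesis
      by (intro runsI[where t = 7] min_inv_Suc[OF assms])
        (simp_all add: execute min_inv_def marked_def constants_def key_def)
  next
    case 2
    with assms False \<pi> show ?thesis
      by (intro runsI[where t = 9] min_inv_Suc[OF assms])
        (simp_all add: execute min_inv_def marked_def constants_def key_def)
  next
    case 3
    with assms False \<pi> show ?thesis
      by (intro runsI[where t = 8] min_inv_Suc[OF assms])
        (simp_all add: execute min_inv_def marked_def constants_def key_def)
  next
    case 4
    with assms False \<pi> show ?thesis
      by (intro runsI[where t = 10] min_inv_Suc[OF assms])
        (simp_all add: execute min_inv_def marked_def constants_def key_def)
  qed
qed

lemma runs_clique_program:
  assumes "{..<n} - set S \<noteq> {}"
  shows "runs clique_program (initial_state n adj \<pi> S) (14 + 21 * n) (\<lambda>s. halted clique_program s \<and>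
    nreg s 0 \<in> {..<n} - set S \<and> (\<forall>u\<in>{..<n} - set S. key (nreg s 0) \<le> key u))"
    (is "runs ?P ?s _ ?Q")
proof -
  \<comment> \<open>Bounds the marking pass by \<open>6 * n\<close>; the passes then cost
    \<open>6 + 5 + 10 = 21\<close> per vertex, and setup, transitions and exit
    \<open>6 + 3 + 4 + 1 = 14\<close>.\<close>
  have "length S \<le> n"
    using card_mono[OF _ S_less] distinct by (simp add: distinct_card)
  have "runs ?P ?s 6 (mark_inv (length S))"
    by (intro runsI[where t = 6])
      (simp_all add: execute initial_state_def encode_nats_def mark_inv_def constants_def nth_append)
  then have "runs ?P ?s (6 + length S * 6) (mark_inv 0)"
    by (rule runs_seq) (rule runs_loop[OF mark_step])
  then have "runs ?P ?s (6 + length S * 6 + 3) (sum_inv n)"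
    by (rule runs_seq, intro runsI[where t = 3])
      (simp_all add: execute mark_inv_def sum_inv_def marked_def constants_def first_cost_def hd_conv_nth)
  then have "runs ?P ?s (6 + length S * 6 + 3 + n * 5) (sum_inv 0)"
    by (rule runs_seq) (rule runs_loop[OF sum_step])
  then have "runs ?P ?s (6 + length S * 6 + 3 + n * 5 + 4) (min_inv n)"
    by (rule runs_seq, intro runsI[where t = 4])
      (simp_all add: execute sum_inv_def min_inv_def marked_def constants_def atLeast0LessThan)
  then have "runs ?P ?s (6 + length S * 6 + 3 + n * 5 + 4 + n * 10) (min_inv 0)"
    by (rule runs_seq) (rule runs_loop[OF min_step])
  then have "runs ?P ?s (6 + length S * 6 + 3 + n * 5 + 4 + n * 10 + 1) ?Q"
    by (rule runs_seq, intro runsI[where t = 1])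
      (use assms in \<open>auto simp: execute min_inv_def marked_def constants_def atLeast0LessThan\<close>)
  then show ?thesis
    by (rule runs_mono) (use \<open>length S \<le> n\<close> in simp)
qed

end

theorem lemma3p1:
  shows "\<exists>(P :: instr list) (T :: nat \<Rightarrow> nat).
    (\<lambda>n. real (T n)) \<in> O(\<lambda>n. real n) \<and>
    (\<forall>(n :: nat) (G :: nat pair_pre_digraph) (\<pi> :: nat \<Rightarrow> real) (S :: nat list)
       (adj :: nat \<Rightarrow> nat list).
       balanced_vertex_instance G \<pi> S \<and> complete_digraph n (with_proj G) \<and>
       pverts G = {..<n} \<and> adjacency_lists G adj \<longrightarrow>
         halts_from P (initial_state n adj \<pi> S) \<and>
         running_time P (initial_state n adj \<pi> S) \<le> T n \<and>
         balanced_vertex_solution G \<pi> S (ram_output P (initial_state n adj \<pi> S)))"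
proof (intro exI conjI allI impI; (elim conjE)?)
  show "(\<lambda>n. real (14 + 21 * n)) \<in> O(\<lambda>n. real n)"
    \<comment> \<open>For \<open>n \<ge> 1\<close> the constant 14 is at most \<open>14 * n\<close>,
      and \<open>14 + 21 = 35\<close>.\<close>
    by (intro bigoI[of _ 35] eventually_mono[OF eventually_ge_at_top[of 1]]) simp
next
  fix n and G :: "nat pair_pre_digraph" and \<pi> :: "nat \<Rightarrow> real" and S :: "nat list"
    and adj :: "nat \<Rightarrow> nat list"
  assume inst: "balanced_vertex_instance G \<pi> S" and complete: "complete_digraph n (with_proj G)"
    and verts: "pverts G = {..<n}"
  let ?s = "initial_state n adj \<pi> S"
  have S: "proper_vertex_list G S" "distinct S" "set S \<subseteq> {..<n}" "{..<n} - set S \<noteq> {}"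
    and nonneg: "\<And>v. v < n \<Longrightarrow> 0 \<le> \<pi> v"
    using inst verts by (auto simp: balanced_vertex_instance_def proper_vertex_list_def)
  let ?key = "key n \<pi> S"
  have "runs clique_program ?s (14 + 21 * n) (\<lambda>s. halted clique_program s \<and>
      nreg s 0 \<in> {..<n} - set S \<and> (\<forall>u\<in>{..<n} - set S. ?key (nreg s 0) \<le> ?key u))"
    by (rule runs_clique_program[OF S(2,3) nonneg S(4)])
  note run = runs_halted[where Q = "\<lambda>v. v \<in> {..<n} - set S \<and>
      (\<forall>u\<in>{..<n} - set S. ?key v \<le> ?key u)", OF this]
  show "halts_from clique_program ?s"
    by (rule run)
  show "running_time clique_program ?s \<le> 14 + 21 * n"
    by (rule run)
  show "balanced_vertex_solution G \<pi> S (ram_output clique_program ?s)"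
    using run(3) S(1) verts
    by (intro balanced_vertex_solution_complete[OF complete _ _ refl])
      (simp_all add: key_def[OF S(2,3) nonneg] first_cost_def[OF S(2,3) nonneg])
qed

end
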